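(* For a soft covering approximation space $S=(U,C_G)$ with finite parameter set, equip $U$ with the topology generated by $C_G$ as a subbase and let $\operatorname{Bnd}(X)=\operatorname{cl}(X)\setminus\operatorname{int}(X)$ denote the topological boundary of $X\subseteq U$ in this topology. In general the soft covering boundary region $BND_S(X)$ cannot be compared with $\operatorname{Bnd}(X)$, i.e. neither inclusion holds in general: there exist a soft covering approximation space $S=(U,C_G)$ with finite parameter set and a subset $X\subseteq U$ with $\operatorname{Bnd}(X)\not\subseteq BND_S(X)$, and there exist a soft covering approximation space $S=(U,C_G)$ with finite parameter set and a subset $Y\subseteq U$ with $BND_S(Y)\not\subseteq\operatorname{Bnd}(Y)$.
   Context: A soft set over $U$ is a pair $G=(F,E)$ with $E$ a set (the parameter set) and $F:E\to P(U)$ a map into the power set of $U$. It is a covering soft set if $\bigcup_{e\in E}F(e)=U$ and $F(e)\neq\emptyset$ for every $e\in E$. For a covering soft set $G$ write $C_G=\{F(e):e\in E\}$; the pair $S=(U,C_G)$ is called a soft covering approximation space. For $x\in U$ the soft minimal description of $x$ is $Md_S(x)=\{F(e): e\in E,\ x\in F(e),\text{ and for all } a\in E,\ x\in F(a)\subseteq F(e)\text{ implies }F(a)=F(e)\}$. For $X\subseteq U$ the soft covering lower approximation is $S_-(X)=\bigcup\{F(e): e\in E,\ F(e)\subseteq X\}$, the soft covering upper approximation is $S^-(X)=S_-(X)\cup\bigcup_{x\in X\setminus S_-(X)}\ \bigcup_{K\in Md_S(x)}K$, and the soft covering boundary region is $BND_S(X)=S^-(X)\setminus S_-(X)$. *)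

theory Defs
  imports "HOL-Analysis.Analysis"
begin

(* A soft set G = (F, E) over U is given by U, the parameter set E and the map F;
   only the values of F on E are relevant. *)

definition soft_set :: "'a set \<Rightarrow> 'e set \<Rightarrow> ('e \<Rightarrow> 'a set) \<Rightarrow> bool" where
  "soft_set U E F \<longleftrightarrow> (\<forall>e\<in>E. F e \<subseteq> U)"

definition covering_soft_set :: "'a set \<Rightarrow> 'e set \<Rightarrow> ('e \<Rightarrow> 'a set) \<Rightarrow> bool" where
  "covering_soft_set U E F \<longleftrightarrow>
     soft_set U E F \<and> (\<Union>e\<in>E. F e) = U \<and> (\<forall>e\<in>E. F e \<noteq> {})"

definition soft_cover :: "'e set \<Rightarrow> ('e \<Rightarrow> 'a set) \<Rightarrow> 'a set set" where
  "soft_cover E F = {F e | e. e \<in> E}"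

definition soft_min_desc :: "'e set \<Rightarrow> ('e \<Rightarrow> 'a set) \<Rightarrow> 'a \<Rightarrow> 'a set set" where
  "soft_min_desc E F x =
     {F e | e. e \<in> E \<and> x \<in> F e \<and> (\<forall>a\<in>E. x \<in> F a \<and> F a \<subseteq> F e \<longrightarrow> F a = F e)}"

definition soft_lower :: "'e set \<Rightarrow> ('e \<Rightarrow> 'a set) \<Rightarrow> 'a set \<Rightarrow> 'a set" where
  "soft_lower E F X = \<Union>{F e | e. e \<in> E \<and> F e \<subseteq> X}"

definition soft_upper :: "'e set \<Rightarrow> ('e \<Rightarrow> 'a set) \<Rightarrow> 'a set \<Rightarrow> 'a set" where
  "soft_upper E F X =
     soft_lower E F X \<union> (\<Union>x\<in>X - soft_lower E F X. \<Union>K\<in>soft_min_desc E F x. K)"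

definition soft_bnd :: "'e set \<Rightarrow> ('e \<Rightarrow> 'a set) \<Rightarrow> 'a set \<Rightarrow> 'a set" where
  "soft_bnd E F X = soft_upper E F X - soft_lower E F X"

(* The carrier of this topology is the union of the cover, i.e. U for a covering soft set. *)
definition soft_topology :: "'e set \<Rightarrow> ('e \<Rightarrow> 'a set) \<Rightarrow> 'a topology" where
  "soft_topology E F = topology_generated_by (soft_cover E F)"

end

theory Submission
  imports Defs
begin

text \<open>
  Both examples use the cover \<open>{0,1}, {1,2}\<close> of \<open>{0,1,2}\<close>. The member \<open>{0,1}\<close> has empty soft
  boundary, but it is not topologically closed, because \<open>2\<close> lies in its closure. Conversely
  \<open>{1}\<close> contains no member of the cover, so \<open>1\<close> lies in its soft boundary, whereas \<open>{1}\<close> is open as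
  the intersection of the two members.
\<close>

text \<open>A member is its own lower approximation, so no point is left to contribute a minimal
  description.\<close>

lemma soft_bnd_member:
  assumes "e \<in> E"
  shows "soft_bnd E F (F e) = {}"
proof -
  have "soft_lower E F (F e) = F e"
    using assms by (auto simp: soft_lower_def)
  then show ?thesis
    by (simp add: soft_bnd_def soft_upper_def)
qed

definition overlap :: "nat \<Rightarrow> nat set" where
  "overlap e = {e, Suc e}"

lemma covering_overlap: "covering_soft_set {0, 1, 2} {0, 1} overlap"
  by (auto simp: covering_soft_set_def soft_set_def overlap_def)

lemma soft_cover_overlap: "soft_cover {0, 1} overlap = {{0, 1}, {1, 2}}"
  by (auto simp: soft_cover_def overlap_def numeral_2_eq_2)

text \<open>Induction on how \<open>T\<close> is generated: the only subbasic set containing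
  \<open>2\<close> is \<open>{1, 2}\<close>, and the implication from \<open>2\<close> to
  \<open>1\<close> survives intersections and unions.\<close>

lemma overlap_open_contains_1:
  assumes "openin (soft_topology {0, 1} overlap) T" and "2 \<in> T"
  shows "1 \<in> T"
proof -
  have "generate_topology_on {{0, 1}, {1, 2}} T"
    using assms(1) unfolding soft_topology_def soft_cover_overlap
    by (rule openin_topology_generated_by)
  then show ?thesis
    using assms(2) by induction auto
qed

lemma overlap_frontier_member:
  "2 \<in> soft_topology {0, 1} overlap frontier_of overlap 0"
proof -
  have "2 \<in> topspace (soft_topology {0, 1} overlap)"
    unfolding soft_topology_def soft_cover_overlap by simp
  \<comment> \<open>Every open neighbourhood of \<open>2\<close> meets \<open>overlap 0\<close> in
    the point \<open>1\<close>.\<close>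
  then have "2 \<in> soft_topology {0, 1} overlap closure_of overlap 0"
    using overlap_open_contains_1 by (auto simp: in_closure_of overlap_def)
  moreover have "2 \<notin> soft_topology {0, 1} overlap interior_of overlap 0"
    using interior_of_subset[of "soft_topology {0, 1} overlap" "overlap 0"]
    by (auto simp: overlap_def)
  ultimately show ?thesis
    by (simp add: frontier_of_def)
qed

lemma overlap_singleton_open: "openin (soft_topology {0, 1} overlap) {1}"
proof -
  have "openin (soft_topology {0, 1} overlap) ({0, 1} \<inter> {1, 2})"
    unfolding soft_topology_def soft_cover_overlap
    by (intro openin_Int topology_generated_by_Basis) auto
  moreover have "{0, 1} \<inter> {1, 2} = {1 :: nat}"
    by auto
  ultimately show ?thesis
    by simp
qed

lemma overlap_soft_bnd_singleton: "1 \<in> soft_bnd {0, 1} overlap {1}"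
proof -
  have "soft_lower {0, 1} overlap {1} = {}"
    by (auto simp: soft_lower_def overlap_def)
  \<comment> \<open>\<open>{0, 1}\<close> is minimal at \<open>1\<close> because the other member
    \<open>{1, 2}\<close> is not contained in it.\<close>
  moreover have "{0, 1} \<in> soft_min_desc {0, 1} overlap 1"
    by (auto simp: soft_min_desc_def overlap_def)
  ultimately show ?thesis
    by (auto simp: soft_bnd_def soft_upper_def)
qed

theorem corollary30:
  shows "(\<exists>(U :: nat set) (E :: nat set) (F :: nat \<Rightarrow> nat set) X.
            covering_soft_set U E F \<and> finite E \<and> X \<subseteq> U \<and>
            \<not> (soft_topology E F) frontier_of X \<subseteq> soft_bnd E F X) \<and>
         (\<exists>(U :: nat set) (E :: nat set) (F :: nat \<Rightarrow> nat set) Y.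
            covering_soft_set U E F \<and> finite E \<and> Y \<subseteq> U \<and>
            \<not> soft_bnd E F Y \<subseteq> (soft_topology E F) frontier_of Y)"
proof (intro conjI exI)
  \<comment> \<open>The covering goal occurs once per example; proving it fixes the witnesses that
    \<open>exI\<close> left schematic.\<close>
  show "covering_soft_set {0, 1, 2} {0, 1} overlap" "covering_soft_set {0, 1, 2} {0, 1} overlap"
    by (rule covering_overlap)+
  show "\<not> soft_topology {0, 1} overlap frontier_of overlap 0 \<subseteq> soft_bnd {0, 1} overlap (overlap 0)"
    using overlap_frontier_member soft_bnd_member[of 0 "{0, 1}" overlap] by auto
  \<comment> \<open>An open set is its own interior, hence disjoint from its frontier.\<close>
  have "1 \<notin> soft_topology {0, 1} overlap frontier_of {1}"
    using overlap_singleton_open by (simp add: frontier_of_def interior_of_openin)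
  then show "\<not> soft_bnd {0, 1} overlap {1} \<subseteq> soft_topology {0, 1} overlap frontier_of {1}"
    using overlap_soft_bnd_singleton by blast
qed (auto simp: overlap_def)

end
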